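(* Let $V$ be a real separable Hilbert space and let $a,b,m$ be symmetric bilinear forms on $V$ such that $a$ is continuous and $V$-coercive, $b$ is weakly continuous, and $m$ is weakly continuous with $m(u,u)>0$ for all nonzero $u\in V$. Define $$\eta_k:=\inf_{Z_k}\sup_{0\ne v\in Z_k}\left\{-\frac{b(v,v)}{m(v,v)}\right\}\in[-\infty,\infty),$$ where the infimum is over all $k$-dimensional subspaces $Z_k$ of $V$. Then the $k$-th variational eigencurve $\mu_k(\lambda)$ of $(a,b,m)$ satisfies $$\lim_{\lambda\to\infty}\frac{\mu_k(\lambda)}{\lambda}=\eta_k$$ (the limit being taken in the extended reals, so that $\eta_k=-\infty$ is allowed).
   Context: "$a$ is continuous and $V$-coercive" means there are constants $0<\kappa_1\le\kappa_2<\infty$ with $\kappa_1\|u\|^2\le a(u,u)\le\kappa_2\|u\|^2$ for all $u\in V$. A symmetric bilinear form $b$ on $V$ is weakly continuous if $u_j\rightharpoonup u$ and $v_j\rightharpoonup v$ weakly in $V$ imply $b(u_j,v_j)\to b(u,v)$. For $\lambda\in\mathbb{R}$ and $k\in\mathbb{N}$ (with $k\le\dim V$ if $V$ is finite dimensional), $\mu_k(\lambda)$ is the $k$-th smallest, counted with multiplicity, of the real numbers $\mu$ for which there is a nonzero $u\in V$ with $a(u,v)-\lambda b(u,v)=\mu\,m(u,v)$ for all $v\in V$; equivalently $\mu_k(\lambda)=\inf_{Z_k}\sup_{0\ne v\in Z_k}\frac{a(v,v)-\lambda b(v,v)}{m(v,v)}$, the infimum being over all $k$-dimensional subspaces $Z_k$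 of $V$. *)

theory Defs
  imports "HOL-Analysis.Analysis"
begin

definition symmetric_bilinear :: "('v::real_vector \<Rightarrow> 'v \<Rightarrow> real) \<Rightarrow> bool" where
  "symmetric_bilinear f \<longleftrightarrow> bilinear f \<and> (\<forall>u v. f u v = f v u)"

definition continuous_coercive :: "('v::real_normed_vector \<Rightarrow> 'v \<Rightarrow> real) \<Rightarrow> bool" where
  "continuous_coercive a \<longleftrightarrow>
     (\<exists>\<kappa>\<^sub>1 \<kappa>\<^sub>2. 0 < \<kappa>\<^sub>1 \<and> \<kappa>\<^sub>1 \<le> \<kappa>\<^sub>2 \<and>
        (\<forall>u. \<kappa>\<^sub>1 * (norm u)\<^sup>2 \<le> a u u \<and> a u u \<le> \<kappa>\<^sub>2 * (norm u)\<^sup>2))"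

definition weakly_tendsto :: "(nat \<Rightarrow> 'v::real_normed_vector) \<Rightarrow> 'v \<Rightarrow> bool" where
  "weakly_tendsto u l \<longleftrightarrow>
     (\<forall>f :: 'v \<Rightarrow> real. bounded_linear f \<longrightarrow> (\<lambda>j. f (u j)) \<longlonglongrightarrow> f l)"

definition weakly_continuous :: "('v::real_normed_vector \<Rightarrow> 'v \<Rightarrow> real) \<Rightarrow> bool" where
  "weakly_continuous b \<longleftrightarrow>
     (\<forall>u v u' v'. weakly_tendsto u u' \<longrightarrow> weakly_tendsto v v' \<longrightarrow>
        (\<lambda>j. b (u j) (v j)) \<longlonglongrightarrow> b u' v')"

text \<open>The library constant \<^const>\<open>dim\<close> is \<open>0\<close> on infinite-dimensional sets, so
  finite dimensionality is always required separately below.\<close>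

definition finite_dim :: "'v::real_vector set \<Rightarrow> bool" where
  "finite_dim S \<longleftrightarrow> (\<exists>B. finite B \<and> S \<subseteq> span B)"

definition subspaces_of_dim :: "nat \<Rightarrow> 'v::real_vector set set" where
  "subspaces_of_dim k = {Z. subspace Z \<and> finite_dim Z \<and> dim Z = k}"

definition eigenspace ::
  "('v::real_vector \<Rightarrow> 'v \<Rightarrow> real) \<Rightarrow> ('v \<Rightarrow> 'v \<Rightarrow> real) \<Rightarrow> ('v \<Rightarrow> 'v \<Rightarrow> real) \<Rightarrow>
     real \<Rightarrow> real \<Rightarrow> 'v set" where
  "eigenspace a b m t \<mu> = {u. \<forall>v. a u v - t * b u v = \<mu> * m u v}"

definition eigenvalues ::
  "('v::real_vector \<Rightarrow> 'v \<Rightarrow> real) \<Rightarrow> ('v \<Rightarrow> 'v \<Rightarrow> real) \<Rightarrow> ('v \<Rightarrow> 'v \<Rightarrow> real) \<Rightarrow>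
     real \<Rightarrow> real set" where
  "eigenvalues a b m t = {\<mu>. \<exists>u. u \<noteq> 0 \<and> u \<in> eigenspace a b m t \<mu>}"

text \<open>The \<open>k\<close>-th smallest eigenvalue counted with multiplicity, for \<open>k \<ge> 1\<close>: there are fewer
  than \<open>k\<close> eigenvalues strictly below \<open>\<mu>\<close> and at least \<open>k\<close> eigenvalues not exceeding \<open>\<mu>\<close>.
  The two finiteness conditions make the sums of multiplicities meaningful.\<close>

definition is_kth_eigenvalue ::
  "('v::real_vector \<Rightarrow> 'v \<Rightarrow> real) \<Rightarrow> ('v \<Rightarrow> 'v \<Rightarrow> real) \<Rightarrow> ('v \<Rightarrow> 'v \<Rightarrow> real) \<Rightarrow>
     nat \<Rightarrow> real \<Rightarrow> real \<Rightarrow> bool" where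
  "is_kth_eigenvalue a b m k t \<mu> \<longleftrightarrow>
     \<mu> \<in> eigenvalues a b m t \<and>
     finite {\<nu> \<in> eigenvalues a b m t. \<nu> \<le> \<mu>} \<and>
     (\<forall>\<nu> \<in> eigenvalues a b m t. \<nu> \<le> \<mu> \<longrightarrow> finite_dim (eigenspace a b m t \<nu>)) \<and>
     (\<Sum>\<nu> \<in> {\<nu> \<in> eigenvalues a b m t. \<nu> < \<mu>}. dim (eigenspace a b m t \<nu>)) < k \<and>
     k \<le> (\<Sum>\<nu> \<in> {\<nu> \<in> eigenvalues a b m t. \<nu> \<le> \<mu>}. dim (eigenspace a b m t \<nu>))"

definition eigencurve ::
  "('v::real_vector \<Rightarrow> 'v \<Rightarrow> real) \<Rightarrow> ('v \<Rightarrow> 'v \<Rightarrow> real) \<Rightarrow> ('v \<Rightarrow> 'v \<Rightarrow> real) \<Rightarrow>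
     nat \<Rightarrow> real \<Rightarrow> real" where
  "eigencurve a b m k t = (THE \<mu>. is_kth_eigenvalue a b m k t \<mu>)"

definition eta ::
  "('v::real_vector \<Rightarrow> 'v \<Rightarrow> real) \<Rightarrow> ('v \<Rightarrow> 'v \<Rightarrow> real) \<Rightarrow> nat \<Rightarrow> ereal" where
  "eta b m k = (INF Z \<in> subspaces_of_dim k. SUP v \<in> Z - {0}. ereal (- (b v v / m v v)))"

end

theory Submission
  imports Defs "HOL-Library.Diagonal_Subsequence"
begin

text \<open>
  The limit is a comparison of Rayleigh quotients. For \<open>t > 0\<close> the quotient of \<open>a - t b\<close> by \<open>m\<close>, divided
  by \<open>t\<close>, is \<open>(1/t) a/m - b/m\<close>. Since \<open>a \<ge> 0\<close>, it is at least \<open>- b/m\<close>, so the min-max principle gives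
  \<open>\<mu>\<^sub>k(t)/t \<ge> \<eta>\<^sub>k\<close> for every \<open>t > 0\<close> (\<open>eta_le_eigencurve_quotient\<close>). Conversely, on one fixed
  \<open>k\<close>-dimensional space \<open>Z\<close> the quotient \<open>a/m\<close> has a finite bound \<open>K\<close>, so \<open>\<mu>\<^sub>k(t)/t\<close> is at most \<open>K/t\<close> plus
  the supremum of \<open>- b/m\<close> over \<open>Z\<close> (\<open>eigencurve_quotient_le\<close>); let \<open>t\<close> tend to infinity and then choose \<open>Z\<close>
  nearly optimal in the definition of \<open>\<eta>\<^sub>k\<close>.

  Most of the work is in the min-max principle, since the eigencurve is defined by counting solutions
  of the eigenvalue equation. Weakly convergent subsequences of bounded sequences
  (\<open>bounded_imp_weakly_convergent_subseq\<close>) drive everything. They give the Garding inequality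
  \<open>\<kappa> \<parallel>v\<parallel>\<^sup>2 \<le> (a - t b)(v,v) + \<sigma> m(v,v)\<close> (\<open>garding\<close>), they exclude infinite
  \<open>m\<close>-orthonormal sequences on which \<open>a - t b\<close> is bounded above
  (\<open>no_m_orthonormal_sequence_with_bounded_pencil\<close>), and they show that the Rayleigh quotient attains its
  minimum on the \<open>m\<close>-complement of finitely many eigenvectors, at another eigenvector
  (\<open>eigenvector_minimising_on_m_complement\<close>). The second fact makes the number of eigenvalues up to a
  bound, with multiplicity, finite; the third produces new eigenvalues until \<open>k\<close> of them are found
  and bounds the quotient from below off the eigenspaces already used.
\<close>

section \<open>Weak compactness in Hilbert space\<close>

lemma quadratic_nonneg_imp_linear_zero:
  fixes \<beta> \<gamma> :: real
  assumes "\<And>s. 0 \<le> s * \<beta> + s\<^sup>2 * \<gamma>"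
  shows "\<beta> = 0"
proof (rule ccontr)
  assume nz: "\<beta> \<noteq> 0"
  define d where "d = 1 + \<bar>\<gamma>\<bar>"
  have d: "d > 0" "\<gamma> < d" by (simp_all add: d_def)
  define s where "s = - \<beta> / d"
  have "s * \<beta> + s\<^sup>2 * \<gamma> = (\<beta> / d)\<^sup>2 * (\<gamma> - d)"
    using d by (simp add: s_def power2_eq_square field_simps)
  moreover have "(\<beta> / d)\<^sup>2 > 0" using nz d by simp
  ultimately have "s * \<beta> + s\<^sup>2 * \<gamma> < 0" using d by (simp add: mult_pos_neg)
  with assms[of s] show False by simp
qed

text \<open>The representer of \<open>f\<close> minimises the functional \<open>J x = \<parallel>x\<parallel>\<^sup>2 - 2 f x\<close>. It is bounded below because \<open>f\<close>
  is bounded, and the parallelogram law makes minimising sequences Cauchy. The derivative of \<open>J\<close>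
  vanishes at the limit, which is the representation.\<close>
lemma riesz_representation:
  fixes f :: "'v::{real_inner,complete_space} \<Rightarrow> real"
  assumes "bounded_linear f"
  obtains z where "\<And>x. f x = inner z x"
proof -
  interpret f: bounded_linear f by fact
  define J where "J x = inner x x - 2 * f x" for x
  obtain K where K: "\<And>x. norm (f x) \<le> norm x * K" using f.bounded by blast
  have "- K\<^sup>2 \<le> J x" for x
  proof -
    have "f x \<le> norm x * K" using K[of x] by simp
    moreover have "0 \<le> (norm x - K)\<^sup>2" by simp
    ultimately show ?thesis
      by (simp add: J_def power2_norm_eq_inner[symmetric] power2_diff algebra_simps)
  qed
  then have bdd: "bdd_below (range J)" by (meson bdd_belowI2)
  define I where "I = Inf (range J)"
  have I_le: "I \<le> J x" for x unfolding I_def using bdd by (simp add: cInf_lower)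
  have "\<exists>x. J x < I + inverse (real (Suc n))" for n
    using cInf_lessD[of "range J" "I + inverse (real (Suc n))"] by (auto simp: I_def)
  then obtain x where x: "\<And>n. J (x n) < I + inverse (real (Suc n))" by metis
  \<comment> \<open>The parallelogram law turns almost minimality into closeness.\<close>
  have par: "(dist u v)\<^sup>2 = 2 * (J u + J v - 2 * J ((1/2) *\<^sub>R (u + v)))" for u v
    by (simp add: dist_norm power2_norm_eq_inner J_def f.add f.scaleR
        inner_add_left inner_add_right inner_diff_left inner_diff_right inner_commute field_simps)
  have close: "(dist (x i) (x j))\<^sup>2 < 4 * inverse (real (Suc N))" if "i \<ge> N" "j \<ge> N" for i j N
  proof -
    define \<epsilon> where "\<epsilon> = inverse (real (Suc N))"
    have "inverse (real (Suc n)) \<le> \<epsilon>" if "n \<ge> N" for n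
      using that unfolding \<epsilon>_def by (intro le_imp_inverse_le) auto
    then have small: "J (x n) < I + \<epsilon>" if "n \<ge> N" for n
      using x[of n] that by (meson add_left_mono less_le_trans)
    have "2 * (p + q - 2 * r) < 4 * \<epsilon>" if "p < I + \<epsilon>" "q < I + \<epsilon>" "I \<le> r" for p q r
      using that by (simp add: algebra_simps)
    from this[OF small[OF that(1)] small[OF that(2)] I_le] show ?thesis
      unfolding par \<epsilon>_def .
  qed
  have "Cauchy x"
  proof (rule metric_CauchyI)
    fix e :: real assume e: "0 < e"
    then obtain N where N: "inverse (real (Suc N)) < e\<^sup>2 / 4"
      using reals_Archimedean[of "e\<^sup>2 / 4"] by auto
    have "dist (x i) (x j) < e" if "i \<ge> N" "j \<ge> N" for i j
    proof (rule power2_less_imp_less)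
      show "(dist (x i) (x j))\<^sup>2 < e\<^sup>2" using close[OF that] N by linarith
    qed (use e in simp)
    then show "\<exists>N. \<forall>i\<ge>N. \<forall>j\<ge>N. dist (x i) (x j) < e" by blast
  qed
  then obtain z where z: "x \<longlonglongrightarrow> z" using Cauchy_convergent convergent_def by blast
  have lim_J: "(\<lambda>n. J (x n)) \<longlonglongrightarrow> J z" unfolding J_def by (intro tendsto_intros z f.tendsto)
  have "(\<lambda>n. I + inverse (real (Suc n))) \<longlonglongrightarrow> I + 0"
    by (intro tendsto_add tendsto_const LIMSEQ_inverse_real_of_nat)
  with lim_J have "J z \<le> I + 0" by (rule LIMSEQ_le) (use x less_imp_le in blast)
  then have Jz: "J z \<le> I" by simp
  have "f y = inner z y" for y
  proof -
    have "0 \<le> s * (2 * (inner z y - f y)) + s\<^sup>2 * inner y y" for s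
      using order_trans[OF Jz I_le[of "z + s *\<^sub>R y"]]
      by (simp add: J_def f.add f.scaleR inner_add_left inner_add_right inner_commute
          power2_eq_square algebra_simps)
    then have "2 * (inner z y - f y) = 0" by (rule quadratic_nonneg_imp_linear_zero)
    then show ?thesis by simp
  qed
  then show ?thesis by (rule that)
qed

lemma weakly_tendsto_iff_inner:
  fixes x :: "nat \<Rightarrow> 'v::{real_inner,complete_space}"
  shows "weakly_tendsto x l \<longleftrightarrow> (\<forall>y. (\<lambda>j. inner (x j) y) \<longlonglongrightarrow> inner l y)"
proof
  assume "weakly_tendsto x l"
  then show "\<forall>y. (\<lambda>j. inner (x j) y) \<longlonglongrightarrow> inner l y"
    unfolding weakly_tendsto_def using bounded_linear_inner_left by blast
next
  assume *: "\<forall>y. (\<lambda>j. inner (x j) y) \<longlonglongrightarrow> inner l y"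
  show "weakly_tendsto x l" unfolding weakly_tendsto_def
  proof (intro allI impI)
    fix f :: "'v \<Rightarrow> real" assume "bounded_linear f"
    then obtain z where "\<And>x. f x = inner z x" using riesz_representation by metis
    then show "(\<lambda>j. f (x j)) \<longlonglongrightarrow> f l" using * by (simp add: inner_commute[of z])
  qed
qed

lemma weakly_tendsto_const: "weakly_tendsto (\<lambda>_. u) u"
  by (simp add: weakly_tendsto_def)

lemma weakly_tendsto_subseq:
  fixes x :: "nat \<Rightarrow> 'a::real_normed_vector"
  assumes "weakly_tendsto x l" "strict_mono r"
  shows "weakly_tendsto (x \<circ> r) l"
  unfolding weakly_tendsto_def
proof (intro allI impI)
  fix f :: "'a \<Rightarrow> real" assume "bounded_linear f"
  then have "(\<lambda>j. f (x j)) \<longlonglongrightarrow> f l" using assms(1) by (simp add: weakly_tendsto_def)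
  from LIMSEQ_subseq_LIMSEQ[OF this assms(2)] show "(\<lambda>j. f ((x \<circ> r) j)) \<longlonglongrightarrow> f l" by (simp add: o_def)
qed

text \<open>Pairing with one fixed vector turns the sequence into a bounded sequence of reals, so a diagonal
  argument over a countable dense set gives a subsequence whose pairing with every vector of that set
  converges. Its limit functional is bounded, and its representer is the weak limit.\<close>
lemma bounded_imp_weakly_convergent_subseq:
  fixes x :: "nat \<Rightarrow> 'v::{real_inner,complete_space}"
  assumes sep: "separable_space (euclidean :: 'v topology)"
    and bd: "\<And>n. norm (x n) \<le> B"
  obtains l r where "strict_mono (r :: nat \<Rightarrow> nat)" "weakly_tendsto (x \<circ> r) l"
proof -
  obtain D :: "'v set" where D: "countable D" "closure D = UNIV"
    using sep by (auto simp: separable_space_def)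
  then have "D \<noteq> {}" by auto
  define d where "d = from_nat_into D"
  have rd: "range d = D" using D \<open>D \<noteq> {}\<close> by (simp add: d_def)
  have B: "0 \<le> B" using bd[of 0] norm_ge_zero order_trans by blast
  interpret subseqs "\<lambda>n s. convergent (\<lambda>i. inner (x (s i)) (d n))"
  proof
    fix n and s :: "nat \<Rightarrow> nat" assume "strict_mono s"
    have "bounded (range (\<lambda>i. inner (x (s i)) (d n)))"
    proof (rule boundedI)
      fix y assume "y \<in> range (\<lambda>i. inner (x (s i)) (d n))"
      then obtain i where "y = inner (x (s i)) (d n)" by auto
      then show "norm y \<le> B * norm (d n)"
        using Cauchy_Schwarz_ineq2[of "x (s i)" "d n"] bd[of "s i"]
        by (simp add: order_trans[OF _ mult_right_mono])
    qed
    then obtain l r where "strict_mono (r :: nat \<Rightarrow> nat)" "((\<lambda>i. inner (x (s i)) (d n)) \<circ> r) \<longlonglongrightarrow> l"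
      using bounded_imp_convergent_subsequence by blast
    then show "\<exists>r'. strict_mono r' \<and> convergent (\<lambda>i. inner (x ((s \<circ> r') i)) (d n))"
      by (auto simp: o_def convergent_def)
  qed
  have conv_d: "convergent (\<lambda>i. inner (x (diagseq i)) (d n))" for n
  proof -
    have "convergent (\<lambda>i. inner (x ((diagseq \<circ> ((+) (Suc n))) i)) (d n))"
    proof (rule diagseq_holds)
      fix r s :: "nat \<Rightarrow> nat" and n assume "strict_mono r" "convergent (\<lambda>i. inner (x (s i)) (d n))"
      then show "convergent (\<lambda>i. inner (x ((s \<circ> r) i)) (d n))"
        using convergent_subseq_convergent[of "\<lambda>i. inner (x (s i)) (d n)" r] by (simp add: o_def)
    qed
    then show ?thesis
      using convergent_ignore_initial_segment[of "\<lambda>i. inner (x (diagseq i)) (d n)" "Suc n"]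
      by (simp add: o_def add.commute)
  qed
  \<comment> \<open>Boundedness carries convergence from the dense set to all test vectors.\<close>
  have conv: "convergent (\<lambda>i. inner (x (diagseq i)) y)" for y
  proof -
    have "Cauchy (\<lambda>i. inner (x (diagseq i)) y)"
    proof (rule metric_CauchyI)
      fix e :: real assume e: "0 < e"
      define \<delta> where "\<delta> = e / (4 * (B + 1))"
      have "0 < \<delta>" using e B by (simp add: \<delta>_def)
      then obtain n where n: "norm (d n - y) < \<delta>"
        using D(2) rd closure_approachable[of y D] by (auto simp: dist_norm)
      obtain N where N: "\<And>i j. i \<ge> N \<Longrightarrow> j \<ge> N \<Longrightarrow>
          dist (inner (x (diagseq i)) (d n)) (inner (x (diagseq j)) (d n)) < e / 2"
        using conv_d[of n] e metric_CauchyD[OF convergent_Cauchy, OF conv_d, of "e/2" n] by auto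
      have "\<bar>inner (x i) (d n - y)\<bar> \<le> e / 4" for i
      proof -
        have "\<bar>inner (x i) (d n - y)\<bar> \<le> norm (x i) * norm (d n - y)" by (rule Cauchy_Schwarz_ineq2)
        also have "\<dots> \<le> (B + 1) * \<delta>" using bd[of i] n B by (intro mult_mono) auto
        also have "\<dots> = e / 4" using B by (simp add: \<delta>_def divide_simps add_nonneg_eq_0_iff)
        finally show ?thesis .
      qed
      then have near: "\<bar>inner (x i) (d n) - inner (x i) y\<bar> \<le> e / 4" for i by (simp add: inner_diff_right)
      have "dist (inner (x (diagseq i)) y) (inner (x (diagseq j)) y) < e" if "i \<ge> N" "j \<ge> N" for i j
        using N[OF that] near[of "diagseq i"] near[of "diagseq j"] unfolding dist_real_def by linarith
      then show "\<exists>N. \<forall>i\<ge>N. \<forall>j\<ge>N. dist (inner (x (diagseq i)) y) (inner (x (diagseq j)) y) < e" by blast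
    qed
    then show ?thesis by (rule Cauchy_convergent)
  qed
  define g where "g y = lim (\<lambda>i. inner (x (diagseq i)) y)" for y
  have g: "(\<lambda>i. inner (x (diagseq i)) y) \<longlonglongrightarrow> g y" for y
    using conv[of y] by (simp add: g_def convergent_LIMSEQ_iff)
  have "bounded_linear g"
  proof (rule bounded_linear_intro)
    show "g (y + z) = g y + g z" for y z
      using tendsto_add[OF g[of y] g[of z]] g[of "y + z"] LIMSEQ_unique
      by (simp add: inner_add_right) blast
    show "g (c *\<^sub>R y) = c *\<^sub>R g y" for c y
      using tendsto_mult_left[OF g[of y], of c] g[of "c *\<^sub>R y"] LIMSEQ_unique by auto
    show "norm (g y) \<le> norm y * B" for y
    proof (rule Lim_bounded[OF tendsto_norm[OF g[of y]], of 0], intro allI impI)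
      fix i
      have "norm (inner (x (diagseq i)) y) \<le> norm (x (diagseq i)) * norm y"
        using Cauchy_Schwarz_ineq2 by simp
      also have "\<dots> \<le> B * norm y" using bd by (intro mult_right_mono) auto
      also have "\<dots> = norm y * B" by simp
      finally show "norm (inner (x (diagseq i)) y) \<le> norm y * B" .
    qed
  qed
  then obtain l where "\<And>y. g y = inner l y" using riesz_representation by metis
  then have "weakly_tendsto (x \<circ> diagseq) l" using g by (simp add: weakly_tendsto_iff_inner)
  with subseq_diagseq show ?thesis by (rule that)
qed

section \<open>Symmetric bilinear forms\<close>

text \<open>Symmetry comes last: it is a permutation rule, so the other eight are used for rewriting
  and symmetry is instantiated by hand.\<close>
lemma symmetric_bilinear_simps:
  assumes "symmetric_bilinear f"
  shows "f (x + y) z = f x z + f y z" "f z (x + y) = f z x + f z y"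
    "f (x - y) z = f x z - f y z" "f z (x - y) = f z x - f z y"
    "f (c *\<^sub>R x) z = c * f x z" "f z (c *\<^sub>R x) = c * f z x"
    "f 0 z = 0" "f z 0 = 0" "f x y = f y x"
  using assms unfolding symmetric_bilinear_def
  by (simp_all add: bilinear_ladd bilinear_radd bilinear_lsub bilinear_rsub
      bilinear_lmul bilinear_rmul bilinear_lzero bilinear_rzero)

lemma symmetric_bilinear_sum_left:
  assumes "symmetric_bilinear f"
  shows "f (\<Sum>i\<in>I. g i) y = (\<Sum>i\<in>I. f (g i) y)"
  using assms by (auto simp: symmetric_bilinear_def bilinear_def intro!: linear_sum)

lemma symmetric_bilinear_zero_on_span:
  assumes f: "symmetric_bilinear f" and B: "\<And>x. x \<in> B \<Longrightarrow> f v x = 0" and x: "x \<in> span B"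
  shows "f v x = 0"
proof -
  have "subspace {x. f v x = 0}" by (simp add: subspace_def symmetric_bilinear_simps[OF f])
  then have "span B \<subseteq> {x. f v x = 0}" using B by (intro span_minimal) auto
  with x show ?thesis by auto
qed

lemma symmetric_bilinear_diff_scale:
  assumes f: "symmetric_bilinear f" and g: "symmetric_bilinear g"
  shows "symmetric_bilinear (\<lambda>u v. f u v - c * g u v)"
  unfolding symmetric_bilinear_def bilinear_def
proof (intro conjI allI)
  show "f u v - c * g u v = f v u - c * g v u" for u v
    by (simp only: symmetric_bilinear_simps(9)[OF f, of u v] symmetric_bilinear_simps(9)[OF g, of u v])
qed (intro linearI;
    simp add: symmetric_bilinear_simps(1-8)[OF f] symmetric_bilinear_simps(1-8)[OF g] algebra_simps)+

text \<open>The difference of the two sides is \<open>f (u - v) (u - v)\<close>.\<close>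
lemma psd_form_sum_le:
  assumes f: "symmetric_bilinear f" and psd: "\<And>v. 0 \<le> f v v"
  shows "f (u + v) (u + v) \<le> 2 * f u u + 2 * f v v"
  using psd[of "u - v"] by (simp add: symmetric_bilinear_simps(1-8)[OF f] symmetric_bilinear_simps(9)[OF f, of v u])

lemma diagonal_nonpos_imp_nonpos_on_span:
  assumes f: "symmetric_bilinear f" and "finite D"
    and "pairwise (\<lambda>x y. f x y = 0) D" and "\<And>x. x \<in> D \<Longrightarrow> f x x \<le> 0" and "v \<in> span D"
  shows "f v v \<le> 0"
  using assms(2-)
proof (induction D arbitrary: v rule: finite_induct)
  case empty
  then show ?case by (simp add: symmetric_bilinear_simps[OF f])
next
  case (insert x D)
  then obtain s where s: "v - s *\<^sub>R x \<in> span D" by (auto simp: span_breakdown_eq)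
  define w where "w = v - s *\<^sub>R x"
  have v: "v = w + s *\<^sub>R x" by (simp add: w_def)
  have "f x y = 0" if "y \<in> D" for y using insert that by (auto simp: pairwise_insert)
  then have "f x w = 0" using s w_def by (auto intro: symmetric_bilinear_zero_on_span[OF f])
  then have "f v v = f w w + s\<^sup>2 * f x x"
    by (simp add: v symmetric_bilinear_simps(1-8)[OF f] symmetric_bilinear_simps(9)[OF f, of w x] power2_eq_square)
  moreover have "f w w \<le> 0" using insert s w_def by (auto simp: pairwise_insert)
  moreover have "s\<^sup>2 * f x x \<le> 0" using insert.prems by (simp add: mult_nonneg_nonpos)
  ultimately show ?case by linarith
qed

section \<open>Orthogonality with respect to a positive form\<close>

locale positive_form =
  fixes m :: "'v::real_vector \<Rightarrow> 'v \<Rightarrow> real"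
  assumes m_form: "symmetric_bilinear m" and m_pos: "\<And>u. u \<noteq> 0 \<Longrightarrow> m u u > 0"
begin

lemmas m_simps = symmetric_bilinear_simps(1-8)[OF m_form]
lemmas m_commute = symmetric_bilinear_simps(9)[OF m_form]

lemma m_nonneg: "0 \<le> m u u"
  using m_pos[of u] by (cases "u = 0") (auto simp: m_simps)

lemma m_zero_iff: "m u u = 0 \<longleftrightarrow> u = 0"
  using m_pos[of u] by (cases "u = 0") (auto simp: m_simps)

text \<open>The projection onto \<open>span (insert x B)\<close> adds to the one onto \<open>span B\<close> the component along \<open>x'\<close>, the
  part of \<open>x\<close> that is \<open>m\<close>-orthogonal to \<open>B\<close>.\<close>
lemma exists_m_projection:
  assumes "finite B"
  shows "\<exists>p\<in>span B. \<forall>x\<in>span B. m (v - p) x = 0"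
  using assms
proof (induction B arbitrary: v rule: finite_induct)
  case empty
  then show ?case by (simp add: m_simps)
next
  case (insert x B)
  obtain p where p: "p \<in> span B" "\<And>y. y \<in> span B \<Longrightarrow> m (v - p) y = 0" using insert.IH by blast
  obtain r where r: "r \<in> span B" "\<And>y. y \<in> span B \<Longrightarrow> m (x - r) y = 0" using insert.IH by blast
  define x' where "x' = x - r"
  have B_sub: "span B \<subseteq> span (insert x B)" by (simp add: span_mono subset_insertI)
  have x': "x' \<in> span (insert x B)"
    unfolding x'_def using r B_sub by (intro span_diff) (auto simp: span_base)
  \<comment> \<open>The division by zero for \<open>x' = 0\<close> is harmless, as the added term then vanishes anyway.\<close>
  define p' where "p' = p + (m v x' / m x' x') *\<^sub>R x'"
  have p': "p' \<in> span (insert x B)" unfolding p'_def using p B_sub x' by (intro span_add span_scale) auto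
  have on_B: "m (v - p') y = 0" if "y \<in> span B" for y
    using p(2)[OF that] r(2)[OF that] by (simp add: p'_def x'_def m_simps)
  have "m p x' = 0" using r(2)[OF p(1)] by (simp add: x'_def m_commute[of p])
  then have on_x': "m (v - p') x' = 0" by (simp add: p'_def m_simps m_zero_iff)
  have "m (v - p') x = 0" using on_x' on_B[OF r(1)] by (simp add: x'_def m_simps)
  then have "m (v - p') y = 0" if "y \<in> insert x B" for y using that on_B span_base by auto
  then show ?case using p' symmetric_bilinear_zero_on_span[OF m_form] by blast
qed

lemma gram_schmidt:
  assumes "finite B"
  obtains C where "finite C" "span C = span B" "pairwise (\<lambda>x y. m x y = 0) C" "0 \<notin> C"
proof -
  have "\<exists>C. finite C \<and> span C = span B \<and> pairwise (\<lambda>x y. m x y = 0) C \<and> 0 \<notin> C"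
    using assms
  proof (induction B rule: finite_induct)
    case empty
    show ?case by (intro exI[of _ "{}"]) auto
  next
    case (insert x B)
    then obtain C where C: "finite C" "span C = span B" "pairwise (\<lambda>x y. m x y = 0) C" "0 \<notin> C" by blast
    obtain p where p: "p \<in> span C" "\<And>y. y \<in> span C \<Longrightarrow> m (x - p) y = 0"
      using exists_m_projection[OF C(1)] by blast
    have "span (insert x B) = span (insert x C)"
      using C(2) by (simp add: span_insert)
    also have "\<dots> = span (insert (x - p) C)"
      using p(1) by (intro eq_span_insert_eq) auto
    finally have sp: "span (insert x B) = span (insert (x - p) C)" .
    show ?case
    proof (cases "x - p = 0")
      case True
      then have "span (insert (x - p) C) = span C" by (simp add: span_insert_0)
      with sp C show ?thesis by metis
    next
      case False
      have "pairwise (\<lambda>x y. m x y = 0) (insert (x - p) C)"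
        using C(3) p(2) span_base by (auto simp: pairwise_insert m_commute[of _ "x - p"])
      with False sp C show ?thesis by (intro exI[of _ "insert (x - p) C"]) auto
    qed
  qed
  then show ?thesis using that by blast
qed

lemma m_orthogonal_independent:
  assumes "finite C" "pairwise (\<lambda>x y. m x y = 0) C" "0 \<notin> C"
  shows "independent C"
proof (rule independent_if_scalars_zero[OF assms(1)])
  fix f y assume 0: "(\<Sum>x\<in>C. f x *\<^sub>R x) = 0" and y: "y \<in> C"
  have "0 = m (\<Sum>x\<in>C. f x *\<^sub>R x) y" by (simp add: 0 m_simps)
  also have "\<dots> = (\<Sum>x\<in>C. f x * m x y)"
    by (simp add: symmetric_bilinear_sum_left[OF m_form] m_simps)
  also have "\<dots> = (\<Sum>x\<in>C. if x = y then f y * m y y else 0)"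
    using assms(2) y by (intro sum.cong) (auto simp: pairwise_def)
  also have "\<dots> = f y * m y y" using y assms(1) by simp
  finally show "f y = 0" using y assms(3) m_zero_iff[of y] by auto
qed

lemma exists_m_orthogonal_basis:
  assumes "subspace Z" "finite_dim Z"
  obtains C where "finite C" "span C = Z" "pairwise (\<lambda>x y. m x y = 0) C" "0 \<notin> C" "card C = dim Z"
proof -
  obtain B where B: "finite B" "Z \<subseteq> span B" using assms by (auto simp: finite_dim_def)
  obtain A where A: "A \<subseteq> Z" "independent A" "Z \<subseteq> span A" by (meson basis_exists)
  have "finite A" using independent_span_bound[OF B(1) A(2)] A(1) B(2) by blast
  then obtain C where C: "finite C" "span C = span A" "pairwise (\<lambda>x y. m x y = 0) C" "0 \<notin> C"
    by (rule gram_schmidt)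
  have "span A = Z" using A assms(1) by (simp add: span_subspace)
  with C show ?thesis using m_orthogonal_independent dim_span_eq_card_independent that by metis
qed

text \<open>Otherwise the \<open>m\<close>-orthogonal projection onto \<open>span C\<close> would embed \<open>span B\<close> in a space of smaller
  dimension.\<close>
lemma exists_m_orthogonal_to_lower_dim:
  assumes B: "independent B" and C: "finite C" and card: "card C < card B"
  shows "\<exists>v\<in>span B. v \<noteq> 0 \<and> (\<forall>x\<in>span C. m v x = 0)"
proof (rule ccontr)
  assume none: "\<not> ?thesis"
  have "\<forall>v. \<exists>p. p \<in> span C \<and> (\<forall>x\<in>span C. m (v - p) x = 0)"
    using exists_m_projection[OF C] by blast
  then obtain P where P: "P v \<in> span C" "x \<in> span C \<Longrightarrow> m (v - P v) x = 0" for v x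
    by (auto simp: choice_iff)
  have P_unique: "P v = p" if "p \<in> span C" "\<And>x. x \<in> span C \<Longrightarrow> m (v - p) x = 0" for v p
  proof -
    have d: "P v - p \<in> span C" using P(1) that(1) by (rule span_diff)
    have "m (P v - p) (P v - p) = m (v - p) (P v - p) - m (v - P v) (P v - p)" by (simp add: m_simps)
    also have "\<dots> = 0" using d P(2) that(2) by simp
    finally show ?thesis by (simp add: m_zero_iff)
  qed
  have lin: "linear P"
  proof (rule linearI)
    fix u v c
    have "m (u + v - (P u + P v)) x = 0" if "x \<in> span C" for x
      using P(2)[OF that, of u] P(2)[OF that, of v] by (simp add: m_simps)
    then show "P (u + v) = P u + P v" using P(1) by (intro P_unique) (auto intro: span_add)
    have "m (c *\<^sub>R u - c *\<^sub>R P u) x = 0" if "x \<in> span C" for x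
      using P(2)[OF that, of u] by (simp add: m_simps flip: scaleR_diff_right)
    then show "P (c *\<^sub>R u) = c *\<^sub>R P u" using P(1) by (intro P_unique) (auto intro: span_scale)
  qed
  have inj: "inj_on P (span B)"
  proof (rule inj_onI)
    fix u v assume uv: "u \<in> span B" "v \<in> span B" "P u = P v"
    have "m (u - v) x = 0" if "x \<in> span C" for x
      using P(2)[OF that, of u] P(2)[OF that, of v] uv(3) by (simp add: m_simps)
    moreover have "u - v \<in> span B" using uv by (simp add: span_diff)
    ultimately show "u = v" using none by auto
  qed
  have "independent (P ` B)" using linear_independent_injective_image[OF lin B inj] .
  moreover have "P ` B \<subseteq> span C" using P(1) by auto
  ultimately have "card (P ` B) \<le> card C" using independent_span_bound[OF C] by blast
  moreover have "card (P ` B) = card B" using inj by (meson card_image inj_on_subset span_superset)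
  ultimately show False using card by simp
qed

text \<open>This applies to \<open>a\<close>, whose quotient by \<open>m\<close> is unbounded on an infinite-dimensional \<open>V\<close>. The induction
  runs over an \<open>m\<close>-orthogonal basis: \<open>m\<close> is additive when a new basis vector joins, and \<open>f\<close> is
  subadditive up to a factor two.\<close>
lemma psd_form_bounded_on_finite_dim:
  assumes f: "symmetric_bilinear f" and psd: "\<And>v. 0 \<le> f v v" and Z: "subspace Z" "finite_dim Z"
  shows "\<exists>K\<ge>0. \<forall>v\<in>Z. f v v \<le> K * m v v"
proof -
  obtain C where C: "finite C" "span C = Z" "pairwise (\<lambda>x y. m x y = 0) C" "0 \<notin> C"
    using exists_m_orthogonal_basis[OF Z] by metis
  have "\<exists>K\<ge>0. \<forall>v\<in>span C. f v v \<le> K * m v v"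
    using C(1,3,4)
  proof (induction C rule: finite_induct)
    case empty
    then show ?case by (intro exI[of _ 0]) (simp add: symmetric_bilinear_simps[OF f])
  next
    case (insert x C)
    then obtain K where K: "K \<ge> 0" "\<And>v. v \<in> span C \<Longrightarrow> f v v \<le> K * m v v"
      by (auto simp: pairwise_insert)
    have mx: "m x x > 0" using insert.prems m_pos by auto
    define K' where "K' = 2 * K + 2 * (f x x / m x x)"
    have "0 \<le> f x x / m x x" using mx psd by simp
    then have K': "2 * K \<le> K'" "2 * (f x x / m x x) \<le> K'" "0 \<le> K'" using K(1) by (auto simp: K'_def)
    have "f v v \<le> K' * m v v" if v_in: "v \<in> span (insert x C)" for v
    proof -
      obtain s where s: "v - s *\<^sub>R x \<in> span C" using v_in span_breakdown_eq[of v x C] by blast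
      define w where "w = v - s *\<^sub>R x"
      have v: "v = w + s *\<^sub>R x" and w: "w \<in> span C" using s by (auto simp: w_def)
      have "m x y = 0" if "y \<in> C" for y using insert that by (auto simp: pairwise_insert)
      then have "m x w = 0" using w by (auto intro: symmetric_bilinear_zero_on_span[OF m_form])
      then have mv: "m v v = m w w + s\<^sup>2 * m x x"
        by (simp add: v m_simps m_commute[of w x] power2_eq_square)
      have "f v v \<le> 2 * f w w + 2 * f (s *\<^sub>R x) (s *\<^sub>R x)"
        unfolding v by (rule psd_form_sum_le[OF f psd])
      also have "f (s *\<^sub>R x) (s *\<^sub>R x) = (f x x / m x x) * (s\<^sup>2 * m x x)"
        using mx by (simp add: symmetric_bilinear_simps(1-8)[OF f] power2_eq_square)
      also have "2 * f w w + 2 * \<dots> \<le> 2 * K * m w w + 2 * (f x x / m x x) * (s\<^sup>2 * m x x)"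
        using K(2)[OF w] by simp
      also have "\<dots> \<le> K' * m w w + K' * (s\<^sup>2 * m x x)"
        using K' m_nonneg[of w] mx by (intro add_mono mult_right_mono) auto
      finally show ?thesis by (simp add: mv algebra_simps)
    qed
    then show ?case using K'(3) by blast
  qed
  with C(2) show ?thesis by simp
qed

end

section \<open>Uniqueness of the \<open>k\<close>-th eigenvalue\<close>

text \<open>If \<open>\<mu> < \<mu>'\<close>, the eigenvalues up to \<open>\<mu>\<close>, of total multiplicity at least \<open>k\<close>, all lie strictly
  below \<open>\<mu>'\<close>, where the total multiplicity is less than \<open>k\<close>.\<close>
lemma is_kth_eigenvalue_unique:
  assumes "is_kth_eigenvalue a b m k t \<mu>" "is_kth_eigenvalue a b m k t \<mu>'"
  shows "\<mu> = \<mu>'"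
proof -
  have False if "is_kth_eigenvalue a b m k t p" "is_kth_eigenvalue a b m k t q" "p < q" for p q
  proof -
    let ?ev = "eigenvalues a b m t" and ?d = "\<lambda>\<nu>. dim (eigenspace a b m t \<nu>)"
    have "finite {\<nu> \<in> ?ev. \<nu> \<le> q}" using that(2) by (simp add: is_kth_eigenvalue_def)
    then have "finite {\<nu> \<in> ?ev. \<nu> < q}" by (rule finite_subset[rotated]) auto
    then have "sum ?d {\<nu> \<in> ?ev. \<nu> \<le> p} \<le> sum ?d {\<nu> \<in> ?ev. \<nu> < q}"
      using that(3) by (intro sum_mono2) auto
    then show False using that(1,2) by (simp add: is_kth_eigenvalue_def)
  qed
  with assms show ?thesis by (meson linorder_neqE)
qed

section \<open>The pencil \<open>a - t b\<close>: coercivity and semicontinuity\<close>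

locale form_triple = positive_form m
  for m :: "'v::{real_inner,complete_space} \<Rightarrow> 'v \<Rightarrow> real" +
  fixes a b :: "'v \<Rightarrow> 'v \<Rightarrow> real"
  assumes separable: "separable_space (euclidean :: 'v topology)"
    and a_form: "symmetric_bilinear a" and b_form: "symmetric_bilinear b"
    and a_coercive: "continuous_coercive a"
    and b_weak: "weakly_continuous b" and m_weak: "weakly_continuous m"
begin

definition pencil :: "real \<Rightarrow> 'v \<Rightarrow> 'v \<Rightarrow> real" where
  "pencil t u v = a u v - t * b u v"

lemma pencil_form: "symmetric_bilinear (pencil t)"
  using symmetric_bilinear_diff_scale[OF a_form b_form, of t] by (simp add: pencil_def[abs_def])

lemmas a_simps = symmetric_bilinear_simps(1-8)[OF a_form]
lemmas b_simps = symmetric_bilinear_simps(1-8)[OF b_form]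
lemmas pencil_simps = symmetric_bilinear_simps(1-8)[OF pencil_form]
lemmas pencil_commute = symmetric_bilinear_simps(9)[OF pencil_form]

lemma mem_eigenspace_iff: "u \<in> eigenspace a b m t \<mu> \<longleftrightarrow> (\<forall>v. pencil t u v = \<mu> * m u v)"
  by (simp add: eigenspace_def pencil_def)

lemma a_nonneg: "0 \<le> a u u"
proof -
  obtain \<kappa> where "0 < \<kappa>" "\<kappa> * (norm u)\<^sup>2 \<le> a u u" using a_coercive by (auto simp: continuous_coercive_def)
  moreover from this have "0 \<le> \<kappa> * (norm u)\<^sup>2" by simp
  ultimately show ?thesis by linarith
qed

text \<open>The term \<open>- t * b\<close> is indefinite and need not be small compared with \<open>a\<close>, but a multiple of \<open>m\<close>
  absorbs it. If no multiple did, there would be unit vectors \<open>w n\<close> with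
  \<open>(n + 1) * m (w n) (w n) + \<kappa> \<le> t * b (w n) (w n)\<close>. A weak limit \<open>l\<close> of them then has \<open>m l l = 0\<close>, so
  \<open>l = 0\<close>, and weak continuity of \<open>b\<close> contradicts \<open>\<kappa> > 0\<close>.\<close>
lemma garding:
  obtains \<kappa> \<sigma> where "0 < \<kappa>" "\<And>v. \<kappa> * (norm v)\<^sup>2 \<le> pencil t v v + \<sigma> * m v v"
proof -
  obtain \<kappa>\<^sub>1 where k1: "0 < \<kappa>\<^sub>1" "\<And>u. \<kappa>\<^sub>1 * (norm u)\<^sup>2 \<le> a u u"
    using a_coercive by (auto simp: continuous_coercive_def)
  \<comment> \<open>Any constant below \<open>\<kappa>\<^sub>1\<close> would do: the difference is the margin that \<open>b\<close> must make up in the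
    contradiction below.\<close>
  define \<kappa> where "\<kappa> = \<kappa>\<^sub>1 / 2"
  have k: "0 < \<kappa>" using k1 by (simp add: \<kappa>_def)
  have "\<exists>\<sigma>. \<forall>v. \<kappa> * (norm v)\<^sup>2 \<le> pencil t v v + \<sigma> * m v v"
  proof (rule ccontr)
    assume "\<not> ?thesis"
    then have "\<exists>v. pencil t v v + real (Suc n) * m v v < \<kappa> * (norm v)\<^sup>2" for n
      by (meson not_less)
    then obtain v where v: "\<And>n. pencil t (v n) (v n) + real (Suc n) * m (v n) (v n) < \<kappa> * (norm (v n))\<^sup>2"
      by metis
    have nz: "v n \<noteq> 0" for n using v[of n] by (auto simp: m_simps pencil_simps)
    define w where "w n = (1 / norm (v n)) *\<^sub>R v n" for n
    have w1: "norm (w n) = 1" for n using nz by (simp add: w_def)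
    have w2: "pencil t (w n) (w n) + real (Suc n) * m (w n) (w n) < \<kappa>" for n
    proof -
      have "pencil t (w n) (w n) + real (Suc n) * m (w n) (w n)
        = (pencil t (v n) (v n) + real (Suc n) * m (v n) (v n)) / (norm (v n))\<^sup>2"
        by (simp add: w_def m_simps pencil_simps power2_eq_square add_divide_distrib)
      also have "\<dots> < \<kappa>" using v[of n] nz[of n] by (simp add: divide_less_eq)
      finally show ?thesis .
    qed
    have w3: "real (Suc n) * m (w n) (w n) + \<kappa> \<le> t * b (w n) (w n)" for n
      using w2[of n] k1(2)[of "w n"] w1[of n] by (simp add: pencil_def \<kappa>_def)
    obtain l r where r: "strict_mono (r :: nat \<Rightarrow> nat)" and wl: "weakly_tendsto (w \<circ> r) l"
      using bounded_imp_weakly_convergent_subseq[OF separable, of w 1] w1 order_refl by metis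
    have bl: "(\<lambda>j. t * b (w (r j)) (w (r j))) \<longlonglongrightarrow> t * b l l"
      using b_weak wl by (intro tendsto_mult_left) (auto simp: weakly_continuous_def o_def)
    have ml: "(\<lambda>j. m (w (r j)) (w (r j))) \<longlonglongrightarrow> m l l"
      using m_weak wl by (auto simp: weakly_continuous_def o_def)
    have m_le: "m (w (r j)) (w (r j)) \<le> t * b (w (r j)) (w (r j)) * inverse (real (Suc j))" for j
    proof -
      have "j \<le> r j" using r by (rule seq_suble)
      then have "real (Suc j) * m (w (r j)) (w (r j)) \<le> real (Suc (r j)) * m (w (r j)) (w (r j))"
        using m_nonneg by (intro mult_right_mono) auto
      also have "\<dots> \<le> t * b (w (r j)) (w (r j))" using w3[of "r j"] k by simp
      finally show ?thesis by (simp add: field_simps)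
    qed
    have "m l l \<le> t * b l l * 0"
      by (rule LIMSEQ_le[OF ml tendsto_mult[OF bl LIMSEQ_inverse_real_of_nat]]) (use m_le in blast)
    then have "l = 0" using m_pos[of l] by force
    moreover have "\<kappa> \<le> t * b l l"
    proof (rule LIMSEQ_le_const[OF bl], intro exI allI impI)
      fix n show "\<kappa> \<le> t * b (w (r n)) (w (r n))"
        using w3[of "r n"] m_nonneg[of "w (r n)"] by (smt (verit) mult_nonneg_nonneg of_nat_0_le_iff)
    qed
    ultimately show False using k by (simp add: b_simps)
  qed
  then show ?thesis using k that by blast
qed

lemma weakly_convergent_subseq_of_bounded_pencil:
  fixes x :: "nat \<Rightarrow> 'v"
  assumes m: "\<And>n. m (x n) (x n) = 1" and q: "\<And>n. pencil t (x n) (x n) \<le> M"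
  obtains l r where "strict_mono (r :: nat \<Rightarrow> nat)" "weakly_tendsto (x \<circ> r) l"
proof -
  obtain \<kappa> \<sigma> where k: "0 < \<kappa>" and g: "\<And>v. \<kappa> * (norm v)\<^sup>2 \<le> pencil t v v + \<sigma> * m v v"
    using garding[of t] by metis
  have "norm (x n) \<le> sqrt ((M + \<sigma>) / \<kappa>)" for n
  proof (rule real_le_rsqrt)
    show "(norm (x n))\<^sup>2 \<le> (M + \<sigma>) / \<kappa>"
      using g[of "x n"] m[of n] q[of n] k by (simp add: field_simps)
  qed
  then show ?thesis using bounded_imp_weakly_convergent_subseq[OF separable] that by metis
qed

text \<open>This is the source of all finiteness statements about the spectrum. A weakly convergent
  subsequence and its shift by one have the same weak limit \<open>l\<close>, and weak continuity of \<open>m\<close> gives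
  \<open>m l l = 1\<close> from the former and \<open>m l l = 0\<close> from pairing the two.\<close>
lemma no_m_orthonormal_sequence_with_bounded_pencil:
  fixes x :: "nat \<Rightarrow> 'v"
  assumes m1: "\<And>n. m (x n) (x n) = 1" and m0: "\<And>i j. i < j \<Longrightarrow> m (x i) (x j) = 0"
    and q: "\<And>n. pencil t (x n) (x n) \<le> M"
  shows False
proof -
  obtain l r where r: "strict_mono (r :: nat \<Rightarrow> nat)" and w: "weakly_tendsto (x \<circ> r) l"
    using weakly_convergent_subseq_of_bounded_pencil[of x t M] m1 q by metis
  have w': "weakly_tendsto (x \<circ> r \<circ> Suc) l" using w by (rule weakly_tendsto_subseq) (simp add: strict_mono_Suc_iff)
  have "(\<lambda>j. m ((x \<circ> r) j) ((x \<circ> r) j)) \<longlonglongrightarrow> m l l"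
    using m_weak w unfolding weakly_continuous_def by blast
  then have "m l l = 1" by (simp add: m1 LIMSEQ_const_iff)
  moreover have "(\<lambda>j. m ((x \<circ> r) j) ((x \<circ> r \<circ> Suc) j)) \<longlonglongrightarrow> m l l"
    using m_weak w w' unfolding weakly_continuous_def by blast
  then have "m l l = 0" using r by (simp add: m0 strict_mono_def LIMSEQ_const_iff)
  ultimately show False by simp
qed

text \<open>The definition of coercivity bounds \<open>a\<close> on the diagonal only; positivity of
  \<open>a (u + v) (u + v)\<close> and \<open>a (u - v) (u - v)\<close> transfers the bound to \<open>a u v\<close>.\<close>
lemma bounded_linear_a_left: "bounded_linear (\<lambda>u. a u v)"
proof -
  obtain \<kappa> where k: "\<And>u. a u u \<le> \<kappa> * (norm u)\<^sup>2" using a_coercive by (auto simp: continuous_coercive_def)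
  define K where "K = \<kappa> + a v v"
  have pol: "\<bar>2 * a u v\<bar> \<le> a u u + a v v" for u
    using a_nonneg[of "u + v"] a_nonneg[of "u - v"]
    by (simp add: a_simps symmetric_bilinear_simps(9)[OF a_form, of v u] abs_le_iff)
  have unit: "\<bar>a u v\<bar> \<le> K" if "norm u = 1" for u
    using pol[of u] k[of u] that a_nonneg[of u] a_nonneg[of v] by (simp add: K_def)
  show ?thesis
  proof (rule bounded_linear_intro)
    show "norm (a u v) \<le> norm u * K" for u
    proof (cases "u = 0")
      case False
      have "a u v = norm u * a ((1 / norm u) *\<^sub>R u) v" using False by (simp add: a_simps)
      then have "\<bar>a u v\<bar> = norm u * \<bar>a ((1 / norm u) *\<^sub>R u) v\<bar>" by (metis abs_mult abs_norm_cancel)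
      also have "\<dots> \<le> norm u * K" using unit False by (intro mult_left_mono) auto
      finally show ?thesis by simp
    qed (simp add: a_simps)
  qed (simp_all add: a_simps)
qed

text \<open>The form \<open>a\<close> is only norm continuous. Being positive, it lies above its tangent at \<open>l\<close>, which is a
  bounded affine functional and hence passes to the weak limit.\<close>
lemma pencil_weakly_lsc:
  assumes w: "weakly_tendsto x l" and q: "(\<lambda>n. pencil t (x n) (x n)) \<longlonglongrightarrow> L"
  shows "pencil t l l \<le> L"
proof -
  have b: "(\<lambda>n. b (x n) (x n)) \<longlonglongrightarrow> b l l"
    using b_weak w unfolding weakly_continuous_def by blast
  have a: "(\<lambda>n. a (x n) l) \<longlonglongrightarrow> a l l"
    using w bounded_linear_a_left unfolding weakly_tendsto_def by blast
  have lim: "(\<lambda>n. 2 * a (x n) l - a l l - t * b (x n) (x n)) \<longlonglongrightarrow> 2 * a l l - a l l - t * b l l"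
    by (intro tendsto_intros a b)
  \<comment> \<open>This is \<open>a (x n - l) (x n - l) \<ge> 0\<close>.\<close>
  have "2 * a (x n) l - a l l - t * b (x n) (x n) \<le> pencil t (x n) (x n)" for n
    using a_nonneg[of "x n - l"]
    by (simp add: pencil_def a_simps symmetric_bilinear_simps(9)[OF a_form, of l "x n"])
  with LIMSEQ_le[OF lim q] show ?thesis by (auto simp: pencil_def)
qed

section \<open>Minimising the Rayleigh quotient\<close>

text \<open>The direct method. On the \<open>m\<close>-complement \<open>W\<close> of \<open>C\<close>, the Garding inequality bounds minimising
  sequences for the Rayleigh quotient, and weak limits stay in \<open>W\<close>, keep \<open>m u u = 1\<close> and do not
  increase the pencil. The minimiser satisfies the eigenvalue equation against vectors of \<open>W\<close> by
  the first variation, and against \<open>C\<close> because both sides vanish on eigenvectors that are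
  \<open>m\<close>-orthogonal to \<open>u\<close>. These two cases suffice, since \<open>W\<close> and \<open>span C\<close> together span \<open>V\<close>.\<close>
lemma eigenvector_minimising_on_m_complement:
  assumes C: "finite C" "\<And>x. x \<in> C \<Longrightarrow> \<exists>\<nu>. x \<in> eigenspace a b m t \<nu>"
    and w0: "w0 \<noteq> 0" "\<And>x. x \<in> C \<Longrightarrow> m w0 x = 0"
  obtains u \<nu> where "u \<noteq> 0" "u \<in> eigenspace a b m t \<nu>" "\<And>x. x \<in> C \<Longrightarrow> m u x = 0"
    "\<And>w. (\<And>x. x \<in> C \<Longrightarrow> m w x = 0) \<Longrightarrow> \<nu> * m w w \<le> pencil t w w"
proof -
  define W where "W = {w. \<forall>x\<in>C. m w x = 0}"
  have W: "u + v \<in> W" "c *\<^sub>R u \<in> W" if "u \<in> W" "v \<in> W" for u v c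
    using that by (auto simp: W_def m_simps)
  define S where "S = {w \<in> W. m w w = 1}"
  have normalise: "(1 / sqrt (m w w)) *\<^sub>R w \<in> S" if "w \<in> W" "w \<noteq> 0" for w
    using W(2)[OF that(1) that(1)] m_pos[OF that(2)] by (simp add: S_def m_simps)
  have "w0 \<in> W" using w0 by (simp add: W_def)
  then have S_ne: "S \<noteq> {}" using normalise w0(1) by blast
  obtain \<kappa> \<sigma> where k: "0 < \<kappa>" and g: "\<And>v. \<kappa> * (norm v)\<^sup>2 \<le> pencil t v v + \<sigma> * m v v"
    using garding[of t] by metis
  have "- \<sigma> \<le> pencil t w w" if "w \<in> S" for w
  proof -
    have "0 \<le> \<kappa> * (norm w)\<^sup>2" using k by simp
    then show ?thesis using g[of w] that by (simp add: S_def)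
  qed
  then have bdd: "bdd_below ((\<lambda>w. pencil t w w) ` S)" by (meson bdd_belowI2)
  define I where "I = (INF w\<in>S. pencil t w w)"
  have I_le: "I \<le> pencil t w w" if "w \<in> S" for w unfolding I_def using bdd that by (rule cINF_lower)
  have "\<exists>w\<in>S. pencil t w w < I + inverse (real (Suc n))" for n
    using cInf_lessD[of "(\<lambda>w. pencil t w w) ` S" "I + inverse (real (Suc n))"] S_ne by (auto simp: I_def)
  then obtain x where xS: "\<And>n. x n \<in> S" and x: "\<And>n. pencil t (x n) (x n) < I + inverse (real (Suc n))" by metis
  have lim_x: "(\<lambda>n. pencil t (x n) (x n)) \<longlonglongrightarrow> I"
  proof (rule real_tendsto_sandwich)
    show "(\<lambda>_::nat. I) \<longlonglongrightarrow> I" by simp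
    show "(\<lambda>n. I + inverse (real (Suc n))) \<longlonglongrightarrow> I"
      using tendsto_add[OF tendsto_const LIMSEQ_inverse_real_of_nat, of I] by simp
    show "\<forall>\<^sub>F n in sequentially. I \<le> pencil t (x n) (x n)"
      using I_le xS by (intro always_eventually) auto
    show "\<forall>\<^sub>F n in sequentially. pencil t (x n) (x n) \<le> I + inverse (real (Suc n))"
      using x by (intro always_eventually allI less_imp_le)
  qed
  have "pencil t (x n) (x n) \<le> I + 1" for n
  proof -
    have "inverse (real (Suc n)) \<le> 1" by (simp add: inverse_le_1_iff)
    then show ?thesis using x[of n] by linarith
  qed
  moreover have xm: "m (x n) (x n) = 1" for n using xS by (simp add: S_def)
  ultimately obtain u r where r: "strict_mono (r :: nat \<Rightarrow> nat)" and w: "weakly_tendsto (x \<circ> r) u"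
    using weakly_convergent_subseq_of_bounded_pencil[of x t "I + 1"] by metis
  have "(\<lambda>j. m ((x \<circ> r) j) ((x \<circ> r) j)) \<longlonglongrightarrow> m u u"
    using m_weak w unfolding weakly_continuous_def by blast
  then have mu: "m u u = 1" using xS by (simp add: S_def LIMSEQ_const_iff)
  have uW: "u \<in> W" unfolding W_def
  proof (intro CollectI ballI)
    fix y assume y: "y \<in> C"
    have "(\<lambda>j. m ((x \<circ> r) j) y) \<longlonglongrightarrow> m u y"
      using m_weak w weakly_tendsto_const[of y] unfolding weakly_continuous_def by blast
    then show "m u y = 0" using xS y by (simp add: S_def W_def LIMSEQ_const_iff)
  qed
  have uS: "u \<in> S" using mu uW by (simp add: S_def)
  have "pencil t u u \<le> I"
    by (rule pencil_weakly_lsc[OF w]) (use LIMSEQ_subseq_LIMSEQ[OF lim_x r] in \<open>simp add: o_def\<close>)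
  with I_le[OF uS] have qu: "pencil t u u = I" by simp
  have min: "I * m v v \<le> pencil t v v" if v: "v \<in> W" for v
  proof (cases "v = 0")
    case False
    have "I \<le> pencil t v v / m v v"
      using I_le[OF normalise[OF v False]] m_pos[OF False]
      by (simp add: pencil_simps real_sqrt_mult_self flip: divide_divide_eq_left')
    then show ?thesis using m_pos[OF False] by (simp add: field_simps)
  qed (simp add: m_simps pencil_simps)
  have crit: "pencil t u v = I * m u v" if v: "v \<in> W" for v
  proof -
    have "0 \<le> s * (2 * (pencil t u v - I * m u v)) + s\<^sup>2 * (pencil t v v - I * m v v)" for s
      using min[OF W(1)[OF uW W(2)[OF v v]], of s] qu mu
      by (simp add: pencil_simps m_simps pencil_commute[of t v u] m_commute[of v u] power2_eq_square algebra_simps)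
    then show ?thesis using quadratic_nonneg_imp_linear_zero by force
  qed
  have on_C: "pencil t u x = I * m u x" if x: "x \<in> C" for x
  proof -
    obtain \<nu> where "\<forall>v. pencil t x v = \<nu> * m x v" using C(2)[OF x] by (auto simp: mem_eigenspace_iff)
    then have "pencil t u x = \<nu> * m u x" by (metis pencil_commute m_commute)
    moreover have "m u x = 0" using uW x by (simp add: W_def)
    ultimately show ?thesis by simp
  qed
  have "pencil t u v - I * m u v = 0" for v
  proof -
    obtain p where p: "p \<in> span C" "\<And>x. x \<in> span C \<Longrightarrow> m (v - p) x = 0"
      using exists_m_projection[OF C(1)] by blast
    \<comment> \<open>Split \<open>v\<close> into its component \<open>p\<close> in \<open>span C\<close> and the remainder in \<open>W\<close>.\<close>
    have "v - p \<in> W" using p(2) by (simp add: W_def span_base)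
    moreover have "pencil t u p - I * m u p = 0"
      by (rule symmetric_bilinear_zero_on_span[OF symmetric_bilinear_diff_scale[OF pencil_form m_form] _ p(1)])
        (simp add: on_C)
    ultimately show ?thesis using crit[of "v - p"] by (simp add: pencil_simps m_simps algebra_simps)
  qed
  then have "u \<in> eigenspace a b m t I" by (simp add: mem_eigenspace_iff)
  moreover have "u \<noteq> 0" using mu by (auto simp: m_simps)
  ultimately show ?thesis using that[of u I] uW min by (auto simp: W_def)
qed

section \<open>Eigenvalues counted with multiplicity\<close>

lemma subspace_eigenspace: "subspace (eigenspace a b m t \<nu>)"
  by (auto simp: subspace_def mem_eigenspace_iff pencil_simps m_simps algebra_simps)

lemma eigenvectors_m_orthogonal:
  assumes "x \<in> eigenspace a b m t \<nu>" "y \<in> eigenspace a b m t \<nu>'" "\<nu> \<noteq> \<nu>'"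
  shows "m x y = 0"
proof -
  have "\<nu> * m x y = pencil t x y" using assms(1) by (simp add: mem_eigenspace_iff)
  also have "\<dots> = pencil t y x" by (rule pencil_commute)
  also have "\<dots> = \<nu>' * m y x" using assms(2) by (simp add: mem_eigenspace_iff)
  also have "\<dots> = \<nu>' * m x y" by (simp add: m_commute[of y x])
  finally show ?thesis using assms(3) by simp
qed

lemma normalised_eigenvector:
  assumes "u \<in> eigenspace a b m t \<nu>" "u \<noteq> 0"
  shows "(1 / sqrt (m u u)) *\<^sub>R u \<in> eigenspace a b m t \<nu>"
    "m ((1 / sqrt (m u u)) *\<^sub>R u) ((1 / sqrt (m u u)) *\<^sub>R u) = 1"
  using assms m_pos[of u] by (simp_all add: subspace_scale[OF subspace_eigenspace] m_simps)

text \<open>Normalised eigenvectors to infinitely many eigenvalues below \<open>M\<close> would be an \<open>m\<close>-orthonormal sequence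
  on which the pencil is at most \<open>M\<close>.\<close>
lemma finite_eigenvalues_le: "finite {\<nu> \<in> eigenvalues a b m t. \<nu> \<le> M}"
proof (rule ccontr)
  assume "infinite {\<nu> \<in> eigenvalues a b m t. \<nu> \<le> M}"
  then obtain f :: "nat \<Rightarrow> real" where f: "inj f" "range f \<subseteq> {\<nu> \<in> eigenvalues a b m t. \<nu> \<le> M}"
    using infinite_countable_subset by blast
  have "\<exists>x. x \<in> eigenspace a b m t (f n) \<and> m x x = 1" for n
  proof -
    obtain u where "u \<in> eigenspace a b m t (f n)" "u \<noteq> 0" using f(2) by (auto simp: eigenvalues_def)
    from normalised_eigenvector[OF this] show ?thesis by blast
  qed
  then obtain x where x: "\<And>n. x n \<in> eigenspace a b m t (f n)" "\<And>n. m (x n) (x n) = 1" by metis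
  show False
  proof (rule no_m_orthonormal_sequence_with_bounded_pencil[of x t M])
    show "m (x i) (x j) = 0" if "i < j" for i j
      using that f(1) by (intro eigenvectors_m_orthogonal[OF x(1) x(1)]) (auto dest: injD)
    show "pencil t (x n) (x n) \<le> M" for n
      using x[of n] f(2) by (auto simp: mem_eigenspace_iff)
  qed (rule x(2))
qed

text \<open>An infinite-dimensional eigenspace would contain an infinite \<open>m\<close>-orthonormal sequence, chosen
  recursively by projecting away the earlier vectors, and the pencil equals \<open>\<nu>\<close> on it.\<close>
lemma finite_dim_eigenspace: "finite_dim (eigenspace a b m t \<nu>)" (is "finite_dim ?E")
proof (rule ccontr)
  assume inf: "\<not> finite_dim ?E"
  define P where "P f n r \<longleftrightarrow> r \<in> ?E \<and> m r r = 1 \<and> (\<forall>i<n. m r (f i) = 0)"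
    for f :: "nat \<Rightarrow> 'v" and n :: nat and r
  have "\<exists>f. \<forall>n. P f n (f n)"
  proof (rule dependent_wellorder_choice)
    fix n f assume f: "\<And>i. i < n \<Longrightarrow> P f i (f i)"
    have fin: "finite (f ` {..<n})" by simp
    then obtain v where v: "v \<in> ?E" "v \<notin> span (f ` {..<n})" using inf unfolding finite_dim_def by blast
    obtain p where p: "p \<in> span (f ` {..<n})" "\<And>x. x \<in> span (f ` {..<n}) \<Longrightarrow> m (v - p) x = 0"
      using exists_m_projection[OF fin] by blast
    have "span (f ` {..<n}) \<subseteq> ?E"
      using f by (intro span_minimal subspace_eigenspace) (auto simp: P_def)
    then have u: "v - p \<in> ?E" using v(1) p(1) by (auto intro: subspace_diff[OF subspace_eigenspace])
    moreover have "v - p \<noteq> 0" using v(2) p(1) by auto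
    moreover have "m (v - p) (f i) = 0" if "i < n" for i using that by (intro p(2) span_base) auto
    ultimately show "\<exists>r. P f n r"
      unfolding P_def using normalised_eigenvector[of "v - p" t \<nu>]
      by (intro exI[of _ "(1 / sqrt (m (v - p) (v - p))) *\<^sub>R (v - p)"]) (simp add: m_simps(5))
  qed (simp add: P_def)
  then obtain x where x: "\<And>n. P x n (x n)" by blast
  show False
  proof (rule no_m_orthonormal_sequence_with_bounded_pencil[of x t \<nu>])
    show "m (x i) (x j) = 0" if "i < j" for i j
      using x[of j] that by (simp add: P_def m_commute[of "x i"])
    show "pencil t (x n) (x n) \<le> \<nu>" for n
      using x[of n] by (simp add: P_def mem_eigenspace_iff)
  qed (use x in \<open>simp add: P_def\<close>)
qed

lemma dim_eigenspace_pos: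
  assumes "\<nu> \<in> eigenvalues a b m t"
  shows "1 \<le> dim (eigenspace a b m t \<nu>)"
proof -
  obtain C where C: "finite C" "span C = eigenspace a b m t \<nu>" "card C = dim (eigenspace a b m t \<nu>)"
    using exists_m_orthogonal_basis[OF subspace_eigenspace finite_dim_eigenspace] by metis
  obtain u where "u \<noteq> 0" "u \<in> span C" using assms C(2) by (auto simp: eigenvalues_def)
  then have "C \<noteq> {}" by auto
  then show ?thesis using C(1,3) by (simp add: Suc_le_eq card_gt_0_iff flip: C(3))
qed

text \<open>Orthogonality between different eigenspaces makes the bases of the single eigenspaces disjoint and
  their union orthogonal, so that the cardinality of \<open>D\<close> is the sum of the multiplicities.\<close>
lemma exists_m_orthogonal_eigenbasis:
  assumes "finite N"
  obtains D where "finite D" "pairwise (\<lambda>x y. m x y = 0) D" "0 \<notin> D"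
    "card D = (\<Sum>\<nu>\<in>N. dim (eigenspace a b m t \<nu>))"
    "\<And>x. x \<in> D \<Longrightarrow> \<exists>\<nu>\<in>N. x \<in> eigenspace a b m t \<nu>"
    "\<And>\<nu>. \<nu> \<in> N \<Longrightarrow> eigenspace a b m t \<nu> \<subseteq> span D"
proof -
  have "\<forall>\<nu>. \<exists>C. finite C \<and> span C = eigenspace a b m t \<nu> \<and> pairwise (\<lambda>x y. m x y = 0) C \<and> 0 \<notin> C
      \<and> card C = dim (eigenspace a b m t \<nu>)"
    using exists_m_orthogonal_basis[OF subspace_eigenspace finite_dim_eigenspace] by metis
  then obtain C where "\<forall>\<nu>. finite (C \<nu>) \<and> span (C \<nu>) = eigenspace a b m t \<nu>
      \<and> pairwise (\<lambda>x y. m x y = 0) (C \<nu>) \<and> 0 \<notin> C \<nu> \<and> card (C \<nu>) = dim (eigenspace a b m t \<nu>)"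
    unfolding choice_iff by blast
  then have C: "finite (C \<nu>)" "span (C \<nu>) = eigenspace a b m t \<nu>" "pairwise (\<lambda>x y. m x y = 0) (C \<nu>)"
    "0 \<notin> C \<nu>" "card (C \<nu>) = dim (eigenspace a b m t \<nu>)" for \<nu> by auto
  have CE: "x \<in> eigenspace a b m t \<nu>" if "x \<in> C \<nu>" for x \<nu>
    using that C(2)[of \<nu>] span_base[of x "C \<nu>"] by auto
  define D where "D = (\<Union>\<nu>\<in>N. C \<nu>)"
  have disj: "C \<nu> \<inter> C \<nu>' = {}" if "\<nu> \<noteq> \<nu>'" for \<nu> \<nu>'
  proof (rule ccontr)
    assume "C \<nu> \<inter> C \<nu>' \<noteq> {}"
    then obtain x where x: "x \<in> C \<nu>" "x \<in> C \<nu>'" by blast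
    then have "m x x = 0" using CE that eigenvectors_m_orthogonal by blast
    then show False using x C(4) by (auto simp: m_zero_iff)
  qed
  show ?thesis
  proof (rule that[of D])
    show "finite D" "0 \<notin> D" using assms C by (auto simp: D_def)
    show "card D = (\<Sum>\<nu>\<in>N. dim (eigenspace a b m t \<nu>))"
      unfolding D_def using assms C disj by (subst card_UN_disjoint) auto
    show "pairwise (\<lambda>x y. m x y = 0) D"
    proof (rule pairwiseI)
      fix x y assume xy: "x \<in> D" "y \<in> D" "x \<noteq> y"
      then obtain \<nu> \<nu>' where "x \<in> C \<nu>" "y \<in> C \<nu>'" by (auto simp: D_def)
      then show "m x y = 0"
        using xy(3) C(3)[of \<nu>] eigenvectors_m_orthogonal[OF CE CE] by (cases "\<nu> = \<nu>'") (auto simp: pairwise_def)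
    qed
    show "\<exists>\<nu>\<in>N. x \<in> eigenspace a b m t \<nu>" if "x \<in> D" for x
      using that CE by (auto simp: D_def)
    show "eigenspace a b m t \<nu> \<subseteq> span D" if "\<nu> \<in> N" for \<nu>
      unfolding C(2)[symmetric] using that by (intro span_mono) (auto simp: D_def)
  qed
qed

text \<open>The minimal Rayleigh quotient on the \<open>m\<close>-complement of the eigenspaces for \<open>N\<close> is a new eigenvalue:
  an eigenvector for an eigenvalue in \<open>N\<close> would be \<open>m\<close>-orthogonal to itself. This yields both the
  existence of further eigenvalues and the lower bound in the min-max principle.\<close>
lemma next_eigenvalue:
  assumes D: "finite D" "\<And>x. x \<in> D \<Longrightarrow> \<exists>\<nu>\<in>N. x \<in> eigenspace a b m t \<nu>"
      "\<And>\<nu>. \<nu> \<in> N \<Longrightarrow> eigenspace a b m t \<nu> \<subseteq> span D"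
    and w0: "w0 \<noteq> 0" "\<And>x. x \<in> D \<Longrightarrow> m w0 x = 0"
  obtains \<nu> where "\<nu> \<in> eigenvalues a b m t" "\<nu> \<notin> N" "\<nu> * m w0 w0 \<le> pencil t w0 w0"
proof -
  obtain u \<nu> where u: "u \<noteq> 0" "u \<in> eigenspace a b m t \<nu>" "\<And>x. x \<in> D \<Longrightarrow> m u x = 0"
    and min: "\<And>w. (\<And>x. x \<in> D \<Longrightarrow> m w x = 0) \<Longrightarrow> \<nu> * m w w \<le> pencil t w w"
    using eigenvector_minimising_on_m_complement[OF D(1), of t w0] D(2) w0 by metis
  have "\<nu> \<notin> N"
  proof
    assume "\<nu> \<in> N"
    then have "u \<in> span D" using D(3) u(2) by blast
    then have "m u u = 0" using u(3) symmetric_bilinear_zero_on_span[OF m_form] by blast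
    then show False using u(1) by (simp add: m_zero_iff)
  qed
  moreover have "\<nu> \<in> eigenvalues a b m t" using u by (auto simp: eigenvalues_def)
  ultimately show ?thesis using that min w0(2) by blast
qed

text \<open>If the total multiplicity never reached \<open>k\<close>, there would be finitely many eigenvalues, and their
  eigenspaces together would have dimension less than \<open>k\<close>. By the dimension hypothesis some nonzero
  vector is then \<open>m\<close>-orthogonal to all of them, which produces yet another eigenvalue. The \<open>k\<close>-th
  eigenvalue is the least one at which the total multiplicity reaches \<open>k\<close>.\<close>
lemma exists_kth_eigenvalue:
  assumes k: "k \<ge> 1" and dimV: "finite_dim (UNIV :: 'v set) \<Longrightarrow> k \<le> dim (UNIV :: 'v set)"
  shows "\<exists>\<mu>. is_kth_eigenvalue a b m k t \<mu>"
proof -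
  let ?ev = "eigenvalues a b m t" and ?d = "\<lambda>\<nu>. dim (eigenspace a b m t \<nu>)"
  define S where "S \<mu> = (\<Sum>\<nu> \<in> {\<nu> \<in> ?ev. \<nu> \<le> \<mu>}. ?d \<nu>)" for \<mu>
  have "\<exists>\<mu>\<in>?ev. k \<le> S \<mu>"
  proof (rule ccontr)
    assume "\<not> ?thesis"
    then have small: "S \<mu> < k" if "\<mu> \<in> ?ev" for \<mu> using that by auto
    have fin: "finite ?ev"
    proof (rule ccontr)
      assume "infinite ?ev"
      then obtain T where T: "T \<subseteq> ?ev" "finite T" "card T = k"
        using infinite_arbitrarily_large by blast
      then have "T \<noteq> {}" using k by auto
      have "card T = (\<Sum>\<nu>\<in>T. 1)" by simp
      also have "\<dots> \<le> (\<Sum>\<nu>\<in>T. ?d \<nu>)" using T dim_eigenspace_pos by (intro sum_mono) auto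
      also have "\<dots> \<le> S (Max T)"
        unfolding S_def using T finite_eigenvalues_le by (intro sum_mono2) auto
      finally have "k \<le> S (Max T)" using T by simp
      moreover have "Max T \<in> ?ev" using T \<open>T \<noteq> {}\<close> Max_in[of T] by blast
      ultimately show False using small[of "Max T"] by simp
    qed
    obtain D where D: "finite D" "card D = sum ?d ?ev"
      "\<And>x. x \<in> D \<Longrightarrow> \<exists>\<nu>\<in>?ev. x \<in> eigenspace a b m t \<nu>"
      "\<And>\<nu>. \<nu> \<in> ?ev \<Longrightarrow> eigenspace a b m t \<nu> \<subseteq> span D"
      using exists_m_orthogonal_eigenbasis[OF fin, of t] by metis
    have "sum ?d ?ev < k"
    proof (cases "?ev = {}")
      case False
      then have "{\<nu> \<in> ?ev. \<nu> \<le> Max ?ev} = ?ev" using fin by auto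
      then show ?thesis using small[of "Max ?ev"] False fin by (simp add: S_def)
    qed (use k in simp)
    with D have card: "card D < k" by simp
    have "\<exists>w. w \<noteq> 0 \<and> (\<forall>x\<in>D. m w x = 0)"
    proof (rule ccontr)
      assume none: "\<not> ?thesis"
      have "v \<in> span D" for v
      proof -
        obtain p where p: "p \<in> span D" "\<And>x. x \<in> span D \<Longrightarrow> m (v - p) x = 0"
          using exists_m_projection[OF D(1)] by blast
        then have "\<forall>x\<in>D. m (v - p) x = 0" using span_base by blast
        with none have "v - p = 0" by blast
        with p(1) show ?thesis by simp
      qed
      then have sub: "UNIV \<subseteq> span D" by auto
      then have "k \<le> dim (UNIV :: 'v set)" using D(1) dimV by (auto simp: finite_dim_def)
      also have "\<dots> \<le> card D" using dim_le_card[OF sub D(1)] .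
      finally show False using card by simp
    qed
    then obtain w where w: "w \<noteq> 0" "\<And>x. x \<in> D \<Longrightarrow> m w x = 0" by blast
    show False by (rule next_eigenvalue[OF D(1) D(3) D(4) w]) simp_all
  qed
  then obtain \<mu>\<^sub>0 where mu0: "\<mu>\<^sub>0 \<in> ?ev" "k \<le> S \<mu>\<^sub>0" by blast
  define F where "F = {\<mu> \<in> ?ev. \<mu> \<le> \<mu>\<^sub>0 \<and> k \<le> S \<mu>}"
  have F: "finite F" by (rule finite_subset[OF _ finite_eigenvalues_le[of t \<mu>\<^sub>0]]) (auto simp: F_def)
  have "F \<noteq> {}" using mu0 by (auto simp: F_def)
  define \<mu> where "\<mu> = Min F"
  have "\<mu> \<in> F" using F \<open>F \<noteq> {}\<close> by (simp add: \<mu>_def)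
  then have mu: "\<mu> \<in> ?ev" "k \<le> S \<mu>" "\<mu> \<le> \<mu>\<^sub>0" by (auto simp: F_def)
  define N where "N = {\<nu> \<in> ?ev. \<nu> < \<mu>}"
  have finN: "finite N" by (rule finite_subset[OF _ finite_eigenvalues_le[of t \<mu>]]) (auto simp: N_def)
  have "sum ?d N < k"
  proof (cases "N = {}")
    case False
    then have MN: "Max N \<in> N" using finN by simp
    define p where "p = Max N"
    have p: "p \<in> ?ev" "p < \<mu>" using MN by (auto simp: p_def N_def)
    have "N = {\<nu> \<in> ?ev. \<nu> \<le> p}"
    proof (intro set_eqI iffI)
      fix \<nu> assume "\<nu> \<in> N"
      then show "\<nu> \<in> {\<nu> \<in> ?ev. \<nu> \<le> p}" using Max_ge[OF finN] by (simp add: p_def N_def)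
    qed (use p(2) in \<open>simp add: N_def\<close>)
    then have "sum ?d N = S p" by (simp add: S_def)
    moreover have "p \<notin> F" using p(2) Min_le[OF F, of p] by (auto simp: \<mu>_def)
    ultimately show ?thesis using p mu(3) by (simp add: F_def)
  qed (use k in simp)
  then have "is_kth_eigenvalue a b m k t \<mu>"
    using mu(1,2) finite_eigenvalues_le[of t \<mu>] finite_dim_eigenspace[of t]
    unfolding is_kth_eigenvalue_def S_def N_def by blast
  then show ?thesis by blast
qed

lemma is_kth_eigenvalue_eigencurve:
  assumes "k \<ge> 1" "finite_dim (UNIV :: 'v set) \<Longrightarrow> k \<le> dim (UNIV :: 'v set)"
  shows "is_kth_eigenvalue a b m k t (eigencurve a b m k t)"
proof -
  obtain \<mu> where mu: "is_kth_eigenvalue a b m k t \<mu>" using exists_kth_eigenvalue[OF assms] by blast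
  show ?thesis
    unfolding eigencurve_def using mu is_kth_eigenvalue_unique[OF _ mu] by (rule theI)
qed

section \<open>Min-max bounds\<close>

text \<open>One half of the min-max principle: the eigenvectors for eigenvalues below \<open>\<mu>\<close> span fewer than \<open>k\<close>
  dimensions, so \<open>Z\<close> contains a nonzero vector \<open>m\<close>-orthogonal to them, and on their \<open>m\<close>-complement
  the Rayleigh quotient is at least the next eigenvalue.\<close>
lemma kth_eigenvalue_le_pencil_somewhere:
  assumes kth: "is_kth_eigenvalue a b m k t \<mu>" and Z: "Z \<in> subspaces_of_dim k"
  obtains v where "v \<in> Z" "v \<noteq> 0" "\<mu> * m v v \<le> pencil t v v"
proof -
  define N where "N = {\<nu> \<in> eigenvalues a b m t. \<nu> < \<mu>}"
  have "finite N" by (rule finite_subset[OF _ finite_eigenvalues_le[of t \<mu>]]) (auto simp: N_def)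
  then obtain D where D: "finite D" "card D = (\<Sum>\<nu>\<in>N. dim (eigenspace a b m t \<nu>))"
      "\<And>x. x \<in> D \<Longrightarrow> \<exists>\<nu>\<in>N. x \<in> eigenspace a b m t \<nu>"
      "\<And>\<nu>. \<nu> \<in> N \<Longrightarrow> eigenspace a b m t \<nu> \<subseteq> span D"
    using exists_m_orthogonal_eigenbasis[of N t] by metis
  obtain B where B: "finite B" "span B = Z" "pairwise (\<lambda>x y. m x y = 0) B" "0 \<notin> B" "card B = k"
    using Z exists_m_orthogonal_basis[of Z] by (auto simp: subspaces_of_dim_def)
  have "card D < card B" using kth D(2) B(5) by (simp add: is_kth_eigenvalue_def N_def)
  then obtain v where v: "v \<in> Z" "v \<noteq> 0" "\<And>x. x \<in> span D \<Longrightarrow> m v x = 0"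
    using exists_m_orthogonal_to_lower_dim[OF m_orthogonal_independent[OF B(1,3,4)] D(1)] B(2) by blast
  obtain \<nu> where nu: "\<nu> \<in> eigenvalues a b m t" "\<nu> \<notin> N" "\<nu> * m v v \<le> pencil t v v"
    using next_eigenvalue[OF D(1) D(3) D(4) v(2)] v(3) span_base by metis
  have "\<mu> * m v v \<le> \<nu> * m v v" using nu(1,2) m_nonneg by (intro mult_right_mono) (auto simp: N_def)
  with nu(3) v(1,2) that show ?thesis by fastforce
qed

text \<open>The other half: the span of \<open>k\<close> of the \<open>m\<close>-orthogonal eigenvectors for eigenvalues up to \<open>\<mu>\<close>.\<close>
lemma pencil_le_kth_eigenvalue_on_some_subspace:
  assumes kth: "is_kth_eigenvalue a b m k t \<mu>"
  obtains Z where "Z \<in> subspaces_of_dim k" "\<And>v. v \<in> Z \<Longrightarrow> pencil t v v \<le> \<mu> * m v v"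
proof -
  define N where "N = {\<nu> \<in> eigenvalues a b m t. \<nu> \<le> \<mu>}"
  have "finite N" unfolding N_def by (rule finite_eigenvalues_le)
  then obtain D where D: "finite D" "pairwise (\<lambda>x y. m x y = 0) D" "0 \<notin> D"
      "card D = (\<Sum>\<nu>\<in>N. dim (eigenspace a b m t \<nu>))"
      "\<And>x. x \<in> D \<Longrightarrow> \<exists>\<nu>\<in>N. x \<in> eigenspace a b m t \<nu>"
    using exists_m_orthogonal_eigenbasis[of N t] by metis
  have "k \<le> card D" using kth D(4) by (simp add: is_kth_eigenvalue_def N_def)
  then obtain B where B: "B \<subseteq> D" "card B = k" "finite B" by (rule obtain_subset_with_card_n)
  have orth: "pairwise (\<lambda>x y. m x y = 0) B" using D(2) B(1) by (rule pairwise_subset)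
  have "independent B" using B D(3) by (intro m_orthogonal_independent orth) auto
  then have "span B \<in> subspaces_of_dim k"
    using B by (auto simp: subspaces_of_dim_def finite_dim_def dim_span_eq_card_independent simp del: dim_span)
  moreover have "pencil t v v - \<mu> * m v v \<le> 0" if v: "v \<in> span B" for v
  proof (rule diagonal_nonpos_imp_nonpos_on_span[OF symmetric_bilinear_diff_scale[OF pencil_form m_form] B(3) _ _ v])
    have E: "\<exists>\<nu>\<le>\<mu>. \<forall>y. pencil t x y = \<nu> * m x y" if "x \<in> B" for x
      using D(5)[of x] B(1) that by (auto simp: N_def mem_eigenspace_iff)
    show "pairwise (\<lambda>x y. pencil t x y - \<mu> * m x y = 0) B"
    proof (rule pairwiseI)
      fix x y assume xy: "x \<in> B" "y \<in> B" "x \<noteq> y"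
      then have "m x y = 0" using orth by (auto simp: pairwise_def)
      with E[OF xy(1)] show "pencil t x y - \<mu> * m x y = 0" by auto
    qed
    show "pencil t x x - \<mu> * m x x \<le> 0" if x: "x \<in> B" for x
    proof -
      obtain \<nu> where "\<nu> \<le> \<mu>" "pencil t x x = \<nu> * m x x" using E[OF x] by blast
      then show ?thesis using m_nonneg[of x] by (simp add: mult_right_mono)
    qed
  qed
  ultimately show ?thesis using that by fastforce
qed

section \<open>Asymptotics of the eigencurves\<close>

text \<open>Dropping the nonnegative \<open>a\<close> from the pencil gives this for each single \<open>t > 0\<close>, not just in the
  limit.\<close>
lemma eta_le_eigencurve_quotient:
  assumes kth: "is_kth_eigenvalue a b m k t \<mu>" and t: "0 < t"
  shows "eta b m k \<le> ereal (\<mu> / t)"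
proof -
  obtain Z where Z: "Z \<in> subspaces_of_dim k" "\<And>v. v \<in> Z \<Longrightarrow> pencil t v v \<le> \<mu> * m v v"
    using pencil_le_kth_eigenvalue_on_some_subspace[OF kth] by metis
  have "- (b v v / m v v) \<le> \<mu> / t" if v: "v \<in> Z - {0}" for v
  proof -
    have "m v v > 0" using m_pos v by auto
    moreover have "t * (- b v v) \<le> \<mu> * m v v" using Z(2)[of v] v a_nonneg[of v] by (simp add: pencil_def)
    ultimately show ?thesis using t by (simp add: field_simps)
  qed
  then have "(SUP v \<in> Z - {0}. ereal (- (b v v / m v v))) \<le> ereal (\<mu> / t)" by (intro SUP_least) auto
  with Z(1) show ?thesis unfolding eta_def by (rule INF_lower2)
qed

text \<open>On a fixed finite-dimensional \<open>Z\<close> the contribution of \<open>a\<close> to the Rayleigh quotient is bounded by a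
  constant, which is lost after division by \<open>t\<close>. It is essential that \<open>K\<close> does not depend on \<open>t\<close>.\<close>
lemma eigencurve_quotient_le:
  assumes Z: "Z \<in> subspaces_of_dim k"
    and r: "\<And>v. v \<in> Z - {0} \<Longrightarrow> - (b v v / m v v) \<le> r"
  obtains K where "\<And>t \<mu>. 0 < t \<Longrightarrow> is_kth_eigenvalue a b m k t \<mu> \<Longrightarrow> \<mu> / t \<le> K / t + r"
proof -
  obtain K where K: "\<And>v. v \<in> Z \<Longrightarrow> a v v \<le> K * m v v"
    using psd_form_bounded_on_finite_dim[OF a_form a_nonneg, of Z] Z by (auto simp: subspaces_of_dim_def)
  have "\<mu> / t \<le> K / t + r" if t: "0 < t" and kth: "is_kth_eigenvalue a b m k t \<mu>" for t \<mu>
  proof -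
    obtain v where v: "v \<in> Z" "v \<noteq> 0" "\<mu> * m v v \<le> pencil t v v"
      using kth_eigenvalue_le_pencil_somewhere[OF kth Z] by metis
    have mv: "m v v > 0" using m_pos v(2) .
    have "- b v v \<le> r * m v v" using r[of v] v mv by (simp add: field_simps)
    then have "t * (- b v v) \<le> t * (r * m v v)" using t by (intro mult_left_mono) auto
    then have "\<mu> * m v v \<le> (K + t * r) * m v v" using v(3) K[OF v(1)] by (simp add: pencil_def algebra_simps)
    then have "\<mu> \<le> K + t * r" using mv by simp
    then show ?thesis using t by (simp add: field_simps)
  qed
  then show ?thesis by (rule that)
qed

text \<open>Given \<open>u\<close> above \<open>eta\<close>, a nearly optimal \<open>Z\<close> has supremum below some real \<open>r < u\<close>. This
  covers \<open>eta = -\<infinity>\<close> as well.\<close>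
lemma eta_less_top_and_eigencurve_limit:
  assumes k: "k \<ge> 1" "finite_dim (UNIV :: 'v set) \<Longrightarrow> k \<le> dim (UNIV :: 'v set)"
  shows "eta b m k < \<infinity> \<and> ((\<lambda>t. ereal (eigencurve a b m k t / t)) \<longlongrightarrow> eta b m k) at_top"
proof
  note kth = is_kth_eigenvalue_eigencurve[OF k]
  show "eta b m k < \<infinity>"
    using eta_le_eigencurve_quotient[OF kth, of 1] by (auto simp: less_top[symmetric])
  show "((\<lambda>t. ereal (eigencurve a b m k t / t)) \<longlongrightarrow> eta b m k) at_top"
  proof (rule order_tendstoI)
    fix l assume l: "l < eta b m k"
    show "\<forall>\<^sub>F t in at_top. l < ereal (eigencurve a b m k t / t)"
      using eventually_gt_at_top[of 0]
      by eventually_elim (use l eta_le_eigencurve_quotient[OF kth] less_le_trans in blast)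
  next
    fix u assume "eta b m k < u"
    then obtain Z where Z: "Z \<in> subspaces_of_dim k" "(SUP v \<in> Z - {0}. ereal (- (b v v / m v v))) < u"
      by (auto simp: eta_def INF_less_iff)
    obtain r where r: "(SUP v \<in> Z - {0}. ereal (- (b v v / m v v))) < ereal r" "ereal r < u"
      using ereal_dense2[OF Z(2)] by blast
    obtain s where s: "ereal r < ereal s" "ereal s < u" using ereal_dense2[OF r(2)] by blast
    have "- (b v v / m v v) \<le> r" if "v \<in> Z - {0}" for v
      using order_trans[OF SUP_upper[OF that] less_imp_le[OF r(1)]] by simp
    then obtain K where K: "\<And>t. 0 < t \<Longrightarrow> eigencurve a b m k t / t \<le> K / t + r"
      using eigencurve_quotient_le[OF Z(1)] kth by metis
    have "((\<lambda>t. K / t + r) \<longlongrightarrow> 0 + r) at_top"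
      by (intro tendsto_intros tendsto_divide_0[OF tendsto_const] filterlim_at_top_imp_at_infinity filterlim_ident)
    then have "\<forall>\<^sub>F t in at_top. K / t + r < s" using s(1) by (intro order_tendstoD(2)) auto
    then show "\<forall>\<^sub>F t in at_top. ereal (eigencurve a b m k t / t) < u"
      using eventually_gt_at_top[of 0]
    proof eventually_elim
      case (elim t)
      then have "ereal (eigencurve a b m k t / t) < ereal s" using K[of t] by simp
      with s(2) show ?case by (rule less_trans[rotated])
    qed
  qed
qed

end

theorem theorem8p3:
  fixes a b m :: "'v::{real_inner, complete_space} \<Rightarrow> 'v \<Rightarrow> real" and k :: nat
  assumes "separable_space (euclidean :: 'v topology)"
    and "symmetric_bilinear a" and "symmetric_bilinear b" and "symmetric_bilinear m"
    and "continuous_coercive a"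
    and "weakly_continuous b"
    and "weakly_continuous m" and "\<And>u. u \<noteq> 0 \<Longrightarrow> m u u > 0"
    and "k \<ge> 1" and "finite_dim (UNIV :: 'v set) \<Longrightarrow> k \<le> dim (UNIV :: 'v set)"
  shows "eta b m k < \<infinity> \<and>
    ((\<lambda>t. ereal (eigencurve a b m k t / t)) \<longlongrightarrow> eta b m k) at_top"
proof -
  interpret form_triple m a b by unfold_locales (fact assms)+
  show ?thesis using assms(9,10) by (rule eta_less_top_and_eigencurve_limit)
qed

end
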